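(* Let $\mathfrak g$ be a $6$-dimensional real nilpotent Lie algebra with a 1-abelian complex structure $J_M$, where $M\in M_2(\mathbb C)$ is Hermitian of full rank. Then there exists a basis $\{\sigma^i\}_{i=1}^3$ of $\mathfrak g^{1,0}$ such that the complex structure equations are one of the following: $$J_{3,2,0}:\ d\sigma^1=d\sigma^2=0,\ d\sigma^3=\sigma^{1\bar 1}+\sigma^{2\bar 2};\qquad J_{3,1,0}:\ d\sigma^1=d\sigma^2=0,\ d\sigma^3=\sigma^{1\bar 1}-\sigma^{2\bar 2}.$$
   Context: For a complex structure $J$ on a real Lie algebra $\mathfrak g$, $\mathfrak g^{1,0}\subset\mathfrak g^*_{\mathbb C}$ is the space of $(1,0)$-forms and $d$ is the Chevalley–Eilenberg differential. We write $\sigma^{j\bar k}=\sigma^j\wedge\overline{\sigma^k}$. $J$ is abelian if $[Jx,Jy]=[x,y]$ for all $x,y$. An abelian complex structure on a $2n$-dimensional nilpotent Lie algebra is 1-abelian if $h^{1,0}=\dim\ker(\bar\partial:\mathfrak g^{1,0}\to\bigwedge^{1,1}\mathfrak g^* )$ equals $n-1$. For every 1-abelian complex structure there are a basis $\{\omega^i\}_{i=1}^n$ of $\mathfrak g^{1,0}$ and a nonzero $M\in M_{n-1}(\mathbb C)$ with $d\omega^1=\dots=d\omega^{n-1}=0$ and $d\omega^n=\sum_{j,k=1}^{n-1}M_{jk}\,\omega^{j\bar k}$; the structure is then denoted $J_M$. *)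

theory Defs
  imports "HOL-Analysis.Analysis" "HOL-Library.Function_Algebras"
begin

section \<open>Real Lie algebras\<close>

definition lie_bracket :: "('g::real_vector \<Rightarrow> 'g \<Rightarrow> 'g) \<Rightarrow> bool" where
  "lie_bracket br \<longleftrightarrow> bilinear br \<and> (\<forall>x. br x x = 0) \<and>
     (\<forall>x y z. br x (br y z) + br y (br z x) + br z (br x y) = 0)"

primrec lower_central :: "('g::real_vector \<Rightarrow> 'g \<Rightarrow> 'g) \<Rightarrow> nat \<Rightarrow> 'g set" where
  "lower_central br 0 = UNIV"
| "lower_central br (Suc k) = span {br x y | x y. y \<in> lower_central br k}"

definition nilpotent_lie_algebra :: "('g::real_vector \<Rightarrow> 'g \<Rightarrow> 'g) \<Rightarrow> bool" where
  "nilpotent_lie_algebra br \<longleftrightarrow> lie_bracket br \<and> (\<exists>k. lower_central br k = {0})"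


section \<open>Complex structures\<close>

text \<open>The last conjunct is the vanishing of the Nijenhuis tensor.\<close>

definition complex_structure :: "('g::real_vector \<Rightarrow> 'g \<Rightarrow> 'g) \<Rightarrow> ('g \<Rightarrow> 'g) \<Rightarrow> bool" where
  "complex_structure br J \<longleftrightarrow> linear J \<and> (\<forall>x. J (J x) = - x) \<and>
     (\<forall>x y. br (J x) (J y) - J (br (J x) y) - J (br x (J y)) - br x y = 0)"

definition abelian_complex_structure :: "('g::real_vector \<Rightarrow> 'g \<Rightarrow> 'g) \<Rightarrow> ('g \<Rightarrow> 'g) \<Rightarrow> bool" where
  "abelian_complex_structure br J \<longleftrightarrow> complex_structure br J \<and> (\<forall>x y. br (J x) (J y) = br x y)"


section \<open>Complex-valued forms\<close>

text \<open>
  The complexified dual of \<open>'g\<close> is identified with the complex space of real-linear maps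
  \<open>'g \<Rightarrow> complex\<close>, and complex-valued 2-forms with functions of two arguments in \<open>'g\<close>.
  Sums, differences and zero of forms are the pointwise ones of \<^theory>\<open>HOL-Library.Function_Algebras\<close>.
\<close>

type_synonym 'g form1 = "'g \<Rightarrow> complex"
type_synonym 'g form2 = "'g \<Rightarrow> 'g \<Rightarrow> complex"

definition scale1 :: "complex \<Rightarrow> 'g form1 \<Rightarrow> 'g form1" where
  "scale1 c \<alpha> = (\<lambda>x. c * \<alpha> x)"

definition scale2 :: "complex \<Rightarrow> 'g form2 \<Rightarrow> 'g form2" where
  "scale2 c \<phi> = (\<lambda>x y. c * \<phi> x y)"

interpretation form1: vector_space "scale1 :: complex \<Rightarrow> 'g form1 \<Rightarrow> 'g form1"
  by unfold_locales (auto simp: scale1_def fun_eq_iff algebra_simps)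

definition conj1 :: "'g form1 \<Rightarrow> 'g form1" where
  "conj1 \<alpha> = (\<lambda>x. cnj (\<alpha> x))"

definition wedge :: "'g form1 \<Rightarrow> 'g form1 \<Rightarrow> 'g form2" where
  "wedge \<alpha> \<beta> = (\<lambda>x y. \<alpha> x * \<beta> y - \<alpha> y * \<beta> x)"

text \<open>The form usually written with superscripts \<open>j\<close> and \<open>k\<close>-bar; only the second factor is conjugated.\<close>

definition mixed :: "(nat \<Rightarrow> 'g form1) \<Rightarrow> nat \<Rightarrow> nat \<Rightarrow> 'g form2" where
  "mixed \<sigma> j k = wedge (\<sigma> j) (conj1 (\<sigma> k))"

text \<open>The Chevalley--Eilenberg differential in degree 1.\<close>

definition ce_diff :: "('g \<Rightarrow> 'g \<Rightarrow> 'g) \<Rightarrow> 'g form1 \<Rightarrow> 'g form2" where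
  "ce_diff br \<alpha> = (\<lambda>x y. - \<alpha> (br x y))"

definition forms10 :: "('g::real_vector \<Rightarrow> 'g) \<Rightarrow> 'g form1 set" where
  "forms10 J = {\<alpha>. linear \<alpha> \<and> (\<forall>x. \<alpha> (J x) = \<i> * \<alpha> x)}"

text \<open>
  The projection of 2-forms onto bidegree (1,1): pulling back along \<open>J\<close> is the identity on
  (1,1)-forms and minus the identity on (2,0)- and (0,2)-forms.  The three lemmas below
  determine it, as wedge products of (1,0)-forms and their conjugates span the 2-forms.
\<close>

definition proj11 :: "('g \<Rightarrow> 'g) \<Rightarrow> 'g form2 \<Rightarrow> 'g form2" where
  "proj11 J \<phi> = (\<lambda>x y. (\<phi> x y + \<phi> (J x) (J y)) / 2)"

lemma proj11_wedge_10_01: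
  assumes "\<alpha> \<in> forms10 J" "\<beta> \<in> forms10 J"
  shows "proj11 J (wedge \<alpha> (conj1 \<beta>)) = wedge \<alpha> (conj1 \<beta>)"
  using assms by (auto simp: proj11_def wedge_def conj1_def forms10_def fun_eq_iff field_simps)

lemma proj11_wedge_10_10:
  assumes "\<alpha> \<in> forms10 J" "\<beta> \<in> forms10 J"
  shows "proj11 J (wedge \<alpha> \<beta>) = 0"
  using assms by (auto simp: proj11_def wedge_def forms10_def fun_eq_iff algebra_simps)

lemma proj11_wedge_01_01:
  assumes "\<alpha> \<in> forms10 J" "\<beta> \<in> forms10 J"
  shows "proj11 J (wedge (conj1 \<alpha>) (conj1 \<beta>)) = 0"
  using assms by (auto simp: proj11_def wedge_def conj1_def forms10_def fun_eq_iff algebra_simps)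

definition dbar :: "('g \<Rightarrow> 'g \<Rightarrow> 'g) \<Rightarrow> ('g \<Rightarrow> 'g) \<Rightarrow> 'g form1 \<Rightarrow> 'g form2" where
  "dbar br J \<alpha> = proj11 J (ce_diff br \<alpha>)"

definition h10 :: "('g::real_vector \<Rightarrow> 'g \<Rightarrow> 'g) \<Rightarrow> ('g \<Rightarrow> 'g) \<Rightarrow> nat" where
  "h10 br J = form1.dim {\<alpha> \<in> forms10 J. dbar br J \<alpha> = 0}"


section \<open>1-abelian complex structures\<close>

text \<open>The condition \<open>h\<^sup>1\<^sup>,\<^sup>0 = n - 1\<close> is written without truncated subtraction.\<close>

definition one_abelian ::
    "nat \<Rightarrow> ('g::real_vector \<Rightarrow> 'g \<Rightarrow> 'g) \<Rightarrow> ('g \<Rightarrow> 'g) \<Rightarrow> bool" where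
  "one_abelian n br J \<longleftrightarrow> nilpotent_lie_algebra br \<and> dim (UNIV :: 'g set) = 2 * n \<and>
     abelian_complex_structure br J \<and> h10 br J + 1 = n"

definition basis10 :: "nat \<Rightarrow> ('g::real_vector \<Rightarrow> 'g) \<Rightarrow> (nat \<Rightarrow> 'g form1) \<Rightarrow> bool" where
  "basis10 n J \<sigma> \<longleftrightarrow> inj_on \<sigma> {1..n} \<and> form1.independent (\<sigma> ` {1..n}) \<and>
     form1.span (\<sigma> ` {1..n}) = forms10 J"

text \<open>
  \<open>J\<close> is the 1-abelian structure \<open>J\<^sub>M\<close> with respect to the basis \<open>\<omega>\<^sup>1, \<dots>, \<omega>\<^sup>n\<close> of
  (1,0)-forms; only the entries \<open>M j k\<close> with \<open>1 \<le> j, k \<le> n - 1\<close> are relevant.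
\<close>

definition one_abelian_frame ::
    "nat \<Rightarrow> ('g::real_vector \<Rightarrow> 'g \<Rightarrow> 'g) \<Rightarrow> ('g \<Rightarrow> 'g) \<Rightarrow>
     (nat \<Rightarrow> nat \<Rightarrow> complex) \<Rightarrow> (nat \<Rightarrow> 'g form1) \<Rightarrow> bool" where
  "one_abelian_frame n br J M \<omega> \<longleftrightarrow>
     one_abelian n br J \<and> basis10 n J \<omega> \<and>
     (\<exists>j\<in>{1..<n}. \<exists>k\<in>{1..<n}. M j k \<noteq> 0) \<and>
     (\<forall>i\<in>{1..<n}. ce_diff br (\<omega> i) = 0) \<and>
     ce_diff br (\<omega> n) = (\<Sum>j\<in>{1..<n}. \<Sum>k\<in>{1..<n}. scale2 (M j k) (mixed \<omega> j k))"

definition hermitian :: "complex^'n^'n \<Rightarrow> bool" where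
  "hermitian M \<longleftrightarrow> (\<forall>i j. M $ i $ j = cnj (M $ j $ i))"

text \<open>
  The entries of a 2 by 2 matrix, indexed by naturals: \<open>of_nat 1 = 1\<close> and \<open>of_nat 2 = 2\<close>
  are the two elements of the index type \<open>2\<close>.
\<close>

definition entry :: "complex^2^2 \<Rightarrow> nat \<Rightarrow> nat \<Rightarrow> complex" where
  "entry M j k = M $ of_nat j $ of_nat k"

end

theory Submission
  imports Defs
begin

text \<open>
  A change of basis \<open>\<sigma>\<^sup>1 = p \<omega>\<^sup>1 + q \<omega>\<^sup>2\<close>, \<open>\<sigma>\<^sup>2 = r \<omega>\<^sup>1 + s \<omega>\<^sup>2\<close> keeps the first two forms closed
  and acts on the coefficient matrix of \<open>d\<omega>\<^sup>3\<close>, in the basis of the (1,1)-forms \<open>\<omega>\<^sup>j \<and> \<omega>\<^sup>k\<close>-bar, by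
  congruence: \<open>\<sigma>\<^sup>1 \<and> \<sigma>\<^sup>1\<close>-bar has coefficient matrix \<open>v v\<^sup>*\<close> with \<open>v = (p, q)\<close>.  So the
  theorem is Sylvester's law of inertia for Hermitian \<open>2 \<times> 2\<close> matrices.  Completing the square
  writes \<open>M\<close> as \<open>d\<^sub>1 v v\<^sup>* + d\<^sub>2 w w\<^sup>*\<close> with real \<open>d\<^sub>1, d\<^sub>2\<close> (\<open>hermitian_form_diagonal\<close>), and
  \<open>det M = d\<^sub>1 d\<^sub>2 \<bar>det (v, w)\<bar>\<^sup>2\<close>, so full rank makes both coefficients and the determinant of the
  change of basis nonzero.  Rescaling \<open>v\<close> and \<open>w\<close> turns the coefficients into signs
  (\<open>hermitian_form_signs\<close>), and taking \<open>\<sigma>\<^sup>3 = \<plusminus>\<omega>\<^sup>3\<close> makes the first of them positive, which leaves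
  exactly the two equations \<open>d\<sigma>\<^sup>3 = \<sigma>\<^sup>1\<^sup>1 \<plusminus> \<sigma>\<^sup>2\<^sup>2\<close> (the second index of each term being barred).
\<close>

lemma full_rank_imp_det_nonzero:
  fixes A :: "'a::field^'n^'n"
  assumes "rank A = CARD('n)"
  shows "det A \<noteq> 0"
proof -
  have "vec.dim (rows A) = vec.dimension TYPE('a) TYPE('n)"
    using assms by (simp add: row_rank_def_gen vec.dimension_def card_cart_basis)
  then have "vec.span (rows A) = UNIV"
    using vec.dim_eq_full by blast
  then show ?thesis
    by (simp add: invertible_det_nz[symmetric] invertible_left_inverse
        matrix_left_invertible_span_rows_gen)
qed

text \<open>
  Completing the square.  When a diagonal entry is nonzero it can be split off; when both vanish,
  the polarisation identity \<open>2 Re (b x y\<^sup>*) = (\<bar>x + b\<^sup>* y\<bar>\<^sup>2 - \<bar>x - b\<^sup>* y\<bar>\<^sup>2) / 2\<close> takes over.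
\<close>

lemma hermitian_form_diagonal:
  fixes a c :: real and b :: complex
  obtains d e :: real and p q r s :: complex
  where "a = d * (p * cnj p) + e * (r * cnj r)"
    and "b = d * (p * cnj q) + e * (r * cnj s)"
    and "c = d * (q * cnj q) + e * (s * cnj s)"
proof -
  have b: "complex_of_real (cmod b) * complex_of_real (cmod b) = b * cnj b"
    using complex_norm_square[of b] by (simp add: power2_eq_square)
  consider "a \<noteq> 0" | "a = 0" "c \<noteq> 0" | "a = 0" "c = 0" by blast
  then show thesis
  proof cases
    case 1
    then show thesis
      by (intro that[of a 1 "c - (cmod b)\<^sup>2 / a" 0 "cnj b / a" 1])
        (simp_all add: b field_simps power2_eq_square)
  next
    case 2
    then show thesis
      by (intro that[of c "b / c" "- (cmod b)\<^sup>2 / c" 1 1 0])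
        (simp_all add: b field_simps power2_eq_square)
  next
    case 3
    then show thesis
      by (intro that[of "1/2" 1 "-1/2" 1 "cnj b" "- cnj b"]) simp_all
  qed
qed

text \<open>
  The absolute values of the coefficients are absorbed into the vectors through their square roots.
  Nondegeneracy is equivalent to nonvanishing of both coefficients and of the determinant of the
  two vectors, because the determinant of the form is the product of the two coefficients and the
  squared modulus of that determinant.  The common factor \<open>t\<close> is the sign in front of the first
  square; it is pulled out because it can be absorbed into the form whose differential is being
  normalised.
\<close>

lemma hermitian_form_signs:
  fixes a c :: real and b :: complex
  assumes nondeg: "of_real (a * c) \<noteq> b * cnj b"
  obtains t e :: real and p q r s :: complex
  where "t = 1 \<or> t = -1" and "e = 1 \<or> e = -1" and "p * s - q * r \<noteq> 0"
    and "a = t * (p * cnj p + e * (r * cnj r))"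
    and "b = t * (p * cnj q + e * (r * cnj s))"
    and "c = t * (q * cnj q + e * (s * cnj s))"
proof -
  obtain d1 d2 :: real and p q r s :: complex
    where a: "a = d1 * (p * cnj p) + d2 * (r * cnj r)"
      and b: "b = d1 * (p * cnj q) + d2 * (r * cnj s)"
      and c: "c = d1 * (q * cnj q) + d2 * (s * cnj s)"
    by (rule hermitian_form_diagonal)
  have "of_real (a * c) - b * cnj b = d1 * d2 * ((p * s - q * r) * cnj (p * s - q * r))"
    unfolding of_real_mult a b c by (simp add: algebra_simps)
  with nondeg have nz: "d1 \<noteq> 0" "d2 \<noteq> 0" "p * s - q * r \<noteq> 0"
    by auto
  define u v where "u = complex_of_real (sqrt \<bar>d1\<bar>)" and "v = complex_of_real (sqrt \<bar>d2\<bar>)"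
  have u: "u * u = of_real \<bar>d1\<bar>" "cnj u = u" and v: "v * v = of_real \<bar>d2\<bar>" "cnj v = v"
    by (simp_all add: u_def v_def flip: of_real_mult)
  have d1: "d1 = complex_of_real (sgn d1) * (u * u)"
    and d2: "d2 = complex_of_real (sgn d1) * (of_real (sgn d1 * sgn d2) * (v * v))"
    unfolding u v of_real_mult[symmetric] of_real_eq_iff using nz by (auto simp: sgn_if)
  show thesis
  proof (rule that[of "sgn d1" "sgn d1 * sgn d2" "u * p" "v * s" "u * q" "v * r"])
    show "sgn d1 = 1 \<or> sgn d1 = -1" "sgn d1 * sgn d2 = 1 \<or> sgn d1 * sgn d2 = -1"
      using nz by (auto simp: sgn_if)
    have "u * p * (v * s) - u * q * (v * r) = u * v * (p * s - q * r)"
      by (simp add: algebra_simps)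
    then show "u * p * (v * s) - u * q * (v * r) \<noteq> 0"
      using nz by (simp add: u_def v_def)
  qed (subst a b c, subst d1, subst d2, simp only: complex_cnj_mult u(2) v(2),
      simp only: ac_simps distrib_left distrib_right)+
qed

lemma cramer:
  fixes p q r s u v :: "'a::field"
  assumes "p * s - q * r \<noteq> 0"
  shows "s / (p * s - q * r) * (p * u + q * v) + - q / (p * s - q * r) * (r * u + s * v) = u"
    and "- r / (p * s - q * r) * (p * u + q * v) + p / (p * s - q * r) * (r * u + s * v) = v"
proof -
  have "s * (p * u + q * v) - q * (r * u + s * v) = (p * s - q * r) * u"
    "p * (r * u + s * v) - r * (p * u + q * v) = (p * s - q * r) * v"
    by (simp_all add: algebra_simps)
  then have "(s * (p * u + q * v) - q * (r * u + s * v)) / (p * s - q * r) = u"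
    "(p * (r * u + s * v) - r * (p * u + q * v)) / (p * s - q * r) = v"
    using assms by simp_all
  then show "s / (p * s - q * r) * (p * u + q * v) + - q / (p * s - q * r) * (r * u + s * v) = u"
    "- r / (p * s - q * r) * (p * u + q * v) + p / (p * s - q * r) * (r * u + s * v) = v"
    by (simp_all add: diff_divide_distrib)
qed

lemma ce_diff_scale1: "ce_diff br (scale1 c \<alpha>) = scale2 c (ce_diff br \<alpha>)"
  by (simp add: ce_diff_def scale1_def scale2_def fun_eq_iff)

lemma ce_diff_add: "ce_diff br (\<alpha> + \<beta>) = ce_diff br \<alpha> + ce_diff br \<beta>"
  by (simp add: ce_diff_def fun_eq_iff)

lemma scale2_zero: "scale2 c 0 = 0"
  by (simp add: scale2_def fun_eq_iff)

text \<open>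
  A family of \<open>n\<close> forms that spans an \<open>n\<close>-dimensional space is a basis.  The space of all forms
  need not be finite dimensional, so the proof extracts a basis from the family and counts.
\<close>

lemma basis10_if_spanning:
  assumes \<omega>: "basis10 n J \<omega>"
    and sub: "\<sigma> ` {1..n} \<subseteq> forms10 J"
    and span: "\<omega> ` {1..n} \<subseteq> form1.span (\<sigma> ` {1..n})"
  shows "basis10 n J \<sigma>"
proof -
  let ?S = "\<sigma> ` {1..n}"
  have \<omega>': "inj_on \<omega> {1..n}" "form1.independent (\<omega> ` {1..n})"
    "form1.span (\<omega> ` {1..n}) = forms10 J"
    using \<omega> by (auto simp: basis10_def)
  have dim: "form1.dim (forms10 J) = n"
    using form1.dim_span_eq_card_independent[OF \<omega>'(2)] card_image[OF \<omega>'(1)] \<omega>'(3)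
    by (simp del: form1.dim_span)
  have spanS: "form1.span ?S = forms10 J"
  proof
    show "form1.span ?S \<subseteq> forms10 J"
      using form1.span_mono[OF sub] \<omega>'(3) form1.span_span by metis
    show "forms10 J \<subseteq> form1.span ?S"
      using form1.span_mono[OF span] \<omega>'(3) form1.span_span by metis
  qed
  obtain B where B: "B \<subseteq> ?S" "form1.independent B" "?S \<subseteq> form1.span B"
    using form1.maximal_independent_subset by blast
  have "form1.span B = forms10 J"
    using form1.span_mono[OF B(1)] form1.span_mono[OF B(3)] spanS form1.span_span by blast
  then have cardB: "card B = n"
    using form1.dim_span_eq_card_independent[OF B(2)] dim by simp
  have "card ?S \<le> n"
    using card_image_le[of "{1..n}" \<sigma>] by simp
  then have "B = ?S"
    using B(1) cardB by (intro card_seteq) auto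
  with B(2) cardB spanS show ?thesis
    by (auto simp: basis10_def intro: eq_card_imp_inj_on)
qed

theorem theorem4p11:
  fixes br :: "'g::real_vector \<Rightarrow> 'g \<Rightarrow> 'g"
    and J :: "'g \<Rightarrow> 'g"
    and M :: "complex^2^2"
    and \<omega> :: "nat \<Rightarrow> 'g form1"
  assumes nilpotent: "nilpotent_lie_algebra br"
    and dim6: "dim (UNIV :: 'g set) = 6"
    and JM: "one_abelian_frame 3 br J (entry M) \<omega>"
    and herm: "hermitian M"
    and full_rank: "rank M = 2"
  shows "\<exists>\<sigma>. basis10 3 J \<sigma> \<and> ce_diff br (\<sigma> 1) = 0 \<and> ce_diff br (\<sigma> 2) = 0 \<and>
           (ce_diff br (\<sigma> 3) = mixed \<sigma> 1 1 + mixed \<sigma> 2 2 \<or>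
            ce_diff br (\<sigma> 3) = mixed \<sigma> 1 1 - mixed \<sigma> 2 2)"
proof -
  have idx: "{1..<3::nat} = {1, 2}" "{1..3::nat} = {1, 2, 3}"
    by auto
  have basis: "basis10 3 J \<omega>" and d12: "ce_diff br (\<omega> 1) = 0" "ce_diff br (\<omega> 2) = 0"
    and d3: "ce_diff br (\<omega> 3) =
      (\<Sum>j\<in>{1,2}. \<Sum>k\<in>{1,2}. scale2 (entry M j k) (mixed \<omega> j k))"
    using JM unfolding one_abelian_frame_def idx by auto
  define a b c where "a = Re (M $ 1 $ 1)" and "b = M $ 1 $ 2" and "c = Re (M $ 2 $ 2)"
  have M: "M $ 1 $ 1 = of_real a" "M $ 1 $ 2 = b" "M $ 2 $ 1 = cnj b" "M $ 2 $ 2 = of_real c"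
    using herm unfolding hermitian_def a_def b_def c_def
    by (metis Reals_cnj_iff of_real_Re)+
  have "det M \<noteq> 0"
    using full_rank by (intro full_rank_imp_det_nonzero) simp
  then have "of_real (a * c) \<noteq> b * cnj b"
    by (simp add: det_2 M)
  then obtain t e :: real and p q r s :: complex
    where t: "t = 1 \<or> t = -1" and e: "e = 1 \<or> e = -1" and det: "p * s - q * r \<noteq> 0"
      and a: "a = t * (p * cnj p + e * (r * cnj r))"
      and b: "b = t * (p * cnj q + e * (r * cnj s))"
      and c: "c = t * (q * cnj q + e * (s * cnj s))"
    by (rule hermitian_form_signs)
  have b': "cnj b = t * (q * cnj p + e * (s * cnj r))"
    by (simp add: b)
  define \<sigma> where "\<sigma> = (\<lambda>i::nat. if i = 1 then scale1 p (\<omega> 1) + scale1 q (\<omega> 2)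
    else if i = 2 then scale1 r (\<omega> 1) + scale1 s (\<omega> 2) else scale1 (of_real t) (\<omega> 3))"
  have \<sigma>: "\<sigma> 1 = scale1 p (\<omega> 1) + scale1 q (\<omega> 2)" "\<sigma> 2 = scale1 r (\<omega> 1) + scale1 s (\<omega> 2)"
    "\<sigma> 3 = scale1 (of_real t) (\<omega> 3)"
    by (simp_all add: \<sigma>_def)
  have "basis10 3 J \<sigma>"
  proof (rule basis10_if_spanning[OF basis])
    have span: "forms10 J = form1.span (\<omega> ` {1, 2, 3})"
      using basis unfolding basis10_def idx by simp
    have "\<omega> 1 \<in> forms10 J" "\<omega> 2 \<in> forms10 J" "\<omega> 3 \<in> forms10 J"
      unfolding span by (blast intro: form1.span_base)+
    then have "\<sigma> 1 \<in> forms10 J" "\<sigma> 2 \<in> forms10 J" "\<sigma> 3 \<in> forms10 J"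
      unfolding span \<sigma> by (blast intro: form1.span_add form1.span_scale)+
    then show "\<sigma> ` {1..3} \<subseteq> forms10 J"
      unfolding idx by blast
    have \<omega>1: "\<omega> 1 = scale1 (s / (p * s - q * r)) (\<sigma> 1) + scale1 (- q / (p * s - q * r)) (\<sigma> 2)"
      and \<omega>2: "\<omega> 2 = scale1 (- r / (p * s - q * r)) (\<sigma> 1) + scale1 (p / (p * s - q * r)) (\<sigma> 2)"
      unfolding \<sigma> scale1_def plus_fun_def fun_eq_iff using cramer[OF det] by simp_all
    have \<omega>3: "\<omega> 3 = scale1 (of_real t) (\<sigma> 3)"
      using t unfolding \<sigma> by (auto simp: scale1_def fun_eq_iff)
    have "\<sigma> 1 \<in> form1.span (\<sigma> ` {1, 2, 3})" "\<sigma> 2 \<in> form1.span (\<sigma> ` {1, 2, 3})"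
      "\<sigma> 3 \<in> form1.span (\<sigma> ` {1, 2, 3})"
      by (blast intro: form1.span_base)+
    then have "\<omega> 1 \<in> form1.span (\<sigma> ` {1, 2, 3})" "\<omega> 2 \<in> form1.span (\<sigma> ` {1, 2, 3})"
      "\<omega> 3 \<in> form1.span (\<sigma> ` {1, 2, 3})"
      unfolding \<omega>1 \<omega>2 \<omega>3 by (blast intro: form1.span_add form1.span_scale)+
    then show "\<omega> ` {1..3} \<subseteq> form1.span (\<sigma> ` {1..3})"
      unfolding idx by blast
  qed
  moreover have "ce_diff br (\<sigma> 1) = 0" "ce_diff br (\<sigma> 2) = 0"
    unfolding \<sigma> by (simp_all only: ce_diff_add ce_diff_scale1 d12 scale2_zero add_0_left)
  moreover have d\<sigma>3: "ce_diff br (\<sigma> 3) = mixed \<sigma> 1 1 + scale2 (of_real e) (mixed \<sigma> 2 2)"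
  proof -
    have "ce_diff br (\<sigma> 3) = scale2 (of_real t) (ce_diff br (\<omega> 3))"
      unfolding \<sigma> by (simp only: ce_diff_scale1)
    \<comment> \<open>one factor \<open>t\<close> comes from \<open>\<sigma>\<^sup>3 = t \<omega>\<^sup>3\<close>, the other from the normal form of \<open>M\<close>\<close>
    also have "\<dots> = scale2 (of_real (t * t)) (mixed \<sigma> 1 1 + scale2 (of_real e) (mixed \<sigma> 2 2))"
      unfolding d3 \<sigma> mixed_def
      by (simp add: entry_def M a b' c wedge_def conj1_def scale1_def scale2_def
          fun_eq_iff) (simp add: b algebra_simps)
    finally show ?thesis
      using t by (auto simp: scale2_def fun_eq_iff)
  qed
  moreover from e have "ce_diff br (\<sigma> 3) = mixed \<sigma> 1 1 + mixed \<sigma> 2 2 \<or>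
      ce_diff br (\<sigma> 3) = mixed \<sigma> 1 1 - mixed \<sigma> 2 2"
    unfolding d\<sigma>3 by (auto simp: scale2_def fun_eq_iff)
  ultimately show ?thesis by blast
qed

end
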